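(* Let $m$ and $n$ be positive integers with $n\leq m$. Then $\gamma_{\{R2\}}(K_n\square K_m)=\min\{m,2n\}$.
   Context: A Roman $\{2\}$-dominating function on a graph $G=(V,E)$ is a function $f:V\to\{0,1,2\}$ such that for every vertex $v$ with $f(v)=0$, $\sum_{u\in N(v)}f(u)\geq 2$. Its weight is $\sum_{v\in V}f(v)$, and $\gamma_{\{R2\}}(G)$ is the minimum weight of such a function. $K_n$ is the complete graph on $n$ vertices. The Cartesian product $G\square H$ has vertex set $V(G)\times V(H)$, with $(u,v)$ adjacent to $(x,y)$ iff either $u=x$ and $vy\in E(H)$, or $v=y$ and $ux\in E(G)$. *)

theory Defs
  imports "Graph_Theory.Graph_Theory" "HOL-Library.FuncSet"
begin

text \<open>
  Graphs are the (finite, simple) graphs of the Graph-Theory library, i.e. symmetric loop-free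
  digraphs: an edge \<open>uv\<close> is represented by the two arcs \<open>(u, v)\<close> and \<open>(v, u)\<close>.
\<close>

definition nbhd :: "('a, 'b) pre_digraph \<Rightarrow> 'a \<Rightarrow> 'a set" where
  "nbhd G v = {u \<in> verts G. (v, u) \<in> arcs_ends G}"

text \<open>Only the values of \<open>f\<close> on \<open>verts G\<close> matter; \<open>f\<close> is unconstrained elsewhere.\<close>

definition roman2_dominating :: "('a, 'b) pre_digraph \<Rightarrow> ('a \<Rightarrow> nat) \<Rightarrow> bool" where
  "roman2_dominating G f \<longleftrightarrow>
     f \<in> verts G \<rightarrow> {0, 1, 2} \<and>
     (\<forall>v \<in> verts G. f v = 0 \<longrightarrow> (\<Sum>u \<in> nbhd G v. f u) \<ge> 2)"

definition weight :: "('a, 'b) pre_digraph \<Rightarrow> ('a \<Rightarrow> nat) \<Rightarrow> nat" where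
  "weight G f = (\<Sum>v \<in> verts G. f v)"

definition gamma_R2 :: "('a, 'b) pre_digraph \<Rightarrow> nat" where
  "gamma_R2 G = (LEAST w. \<exists>f. roman2_dominating G f \<and> weight G f = w)"

text \<open>The minimum defining \<^const>\<open>gamma_R2\<close> is always attained: the constant function 2 is
  dominating.\<close>

lemma gamma_R2_attained: "\<exists>f. roman2_dominating G f \<and> weight G f = gamma_R2 G"
proof -
  have "roman2_dominating G (\<lambda>_. 2)" by (simp add: roman2_dominating_def)
  then have "\<exists>w f. roman2_dominating G f \<and> weight G f = w" by blast
  then show ?thesis unfolding gamma_R2_def by (rule LeastI_ex)
qed

lemma gamma_R2_le: "roman2_dominating G f \<Longrightarrow> gamma_R2 G \<le> weight G f"
  unfolding gamma_R2_def by (rule Least_le) blast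

definition cartesian_product ::
    "'a pair_pre_digraph \<Rightarrow> 'b pair_pre_digraph \<Rightarrow> ('a \<times> 'b) pair_pre_digraph" where
  "cartesian_product G H =
     \<lparr>pverts = pverts G \<times> pverts H,
      parcs = {((u, v), (x, y)) | u v x y.
        (u, v) \<in> pverts G \<times> pverts H \<and> (x, y) \<in> pverts G \<times> pverts H \<and>
        (u = x \<and> (v, y) \<in> parcs H \<or> v = y \<and> (u, x) \<in> parcs G)}\<rparr>"

lemma pair_graph_cartesian_product:
  assumes "pair_graph G" "pair_graph H"
  shows "pair_graph (cartesian_product G H)"
proof -
  interpret G: pair_graph G by fact
  interpret H: pair_graph H by fact
  let ?P = "cartesian_product G H"
  have "parcs ?P \<subseteq> (pverts G \<times> pverts H) \<times> (pverts G \<times> pverts H)"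
    by (auto simp: cartesian_product_def)
  then have "finite (parcs ?P)"
    by (rule finite_subset) simp
  moreover have "symmetric ?P"
  proof -
    have "(b, a) \<in> parcs G" if "(a, b) \<in> parcs G" for a b
      using that by (rule G.arcs_symmetric)
    moreover have "(b, a) \<in> parcs H" if "(a, b) \<in> parcs H" for a b
      using that by (rule H.arcs_symmetric)
    ultimately show ?thesis
      by (auto simp: symmetric_def sym_def cartesian_product_def)
  qed
  ultimately show ?thesis
    by unfold_locales
      (auto simp: cartesian_product_def dest: G.no_loops' H.no_loops')
qed

end

theory Submission
  imports Defs
begin

text \<open>
  Arrange the vertices as a grid with \<open>n\<close> rows and \<open>m\<close> columns, so that a vertex of value 0 sees
  exactly its row sum plus its column sum. If a dominating function has weight less than \<open>m\<close>, some
  column sum vanishes; every row then meets this column in a vertex of value 0, so every row sum is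
  at least 2 and the weight is at least \<open>2 n\<close>. The bound \<open>2 n\<close> is attained by a column of 2s; the
  bound \<open>m\<close> is attained by one value 1 in each column, placed so that every row is hit, which
  is possible because \<open>n \<le> m\<close>.
\<close>

lemma pverts_cartesian_product:
  "pverts (cartesian_product G H) = pverts G \<times> pverts H"
  by (simp add: cartesian_product_def)

lemma weight_cartesian_product:
  "weight (with_proj (cartesian_product G H)) f = (\<Sum>u \<in> pverts G. \<Sum>v \<in> pverts H. f (u, v))"
  by (simp add: weight_def pverts_cartesian_product sum.cartesian_product)

text \<open>Summing column by column serves the two bounds by \<open>m\<close>, where each column
  contributes at least or exactly 1. The row order serves the two bounds by
  \<open>2 * n\<close>.\<close>

lemma weight_cartesian_product':
  "weight (with_proj (cartesian_product G H)) f = (\<Sum>v \<in> pverts H. \<Sum>u \<in> pverts G. f (u, v))"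
  unfolding weight_cartesian_product by (rule sum.swap)

locale complete_grid =
  fixes G :: "'a pair_pre_digraph" and H :: "'b pair_pre_digraph" and n m :: nat
  assumes complete: "complete_digraph n (with_proj G)" "complete_digraph m (with_proj H)"
begin

lemma fin: "finite (pverts G)" "finite (pverts H)"
  and card_verts: "card (pverts G) = n" "card (pverts H) = m"
  and parcs: "parcs G = {(u, v). (u, v) \<in> pverts G \<times> pverts G \<and> u \<noteq> v}"
    "parcs H = {(u, v). (u, v) \<in> pverts H \<times> pverts H \<and> u \<noteq> v}"
  using complete by (simp_all add: complete_digraph_pair_def)

lemma nbhd_grid:
  assumes "u \<in> pverts G" "v \<in> pverts H"
  shows "nbhd (with_proj (cartesian_product G H)) (u, v) =
    Pair u ` (pverts H - {v}) \<union> (\<lambda>x. (x, v)) ` (pverts G - {u})"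
  using assms
  by (auto simp: parcs nbhd_def cartesian_product_def)

text \<open>The neighbours of \<open>(u, v)\<close> are the rest of its row and the rest of its
  column, which are disjoint. Since \<open>f (u, v) = 0\<close>, putting the vertex back into both
  sums changes neither, so full row and column sums may be used.\<close>

lemma sum_nbhd_grid:
  fixes f :: "'a \<times> 'b \<Rightarrow> nat"
  assumes "u \<in> pverts G" "v \<in> pverts H" "f (u, v) = 0"
  shows "sum f (nbhd (with_proj (cartesian_product G H)) (u, v)) =
    (\<Sum>y \<in> pverts H. f (u, y)) + (\<Sum>x \<in> pverts G. f (x, v))"
proof -
  have "sum f (nbhd (with_proj (cartesian_product G H)) (u, v)) =
      sum f (Pair u ` (pverts H - {v})) + sum f ((\<lambda>x. (x, v)) ` (pverts G - {u}))"
    unfolding nbhd_grid[OF assms(1,2)] using fin by (intro sum.union_disjoint) auto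
  also have "\<dots> = (\<Sum>y \<in> pverts H - {v}. f (u, y)) + (\<Sum>x \<in> pverts G - {u}. f (x, v))"
    by (simp add: sum.reindex inj_on_def)
  also have "\<dots> = (\<Sum>y \<in> pverts H. f (u, y)) + (\<Sum>x \<in> pverts G. f (x, v))"
    using assms fin by (simp add: sum_diff1_nat)
  finally show ?thesis .
qed

lemma roman2_dominating_grid_iff:
  "roman2_dominating (with_proj (cartesian_product G H)) f \<longleftrightarrow>
    f \<in> pverts G \<times> pverts H \<rightarrow> {0, 1, 2} \<and>
    (\<forall>u \<in> pverts G. \<forall>v \<in> pverts H. f (u, v) = 0 \<longrightarrow>
      2 \<le> (\<Sum>y \<in> pverts H. f (u, y)) + (\<Sum>x \<in> pverts G. f (x, v)))"
  by (auto simp: roman2_dominating_def pverts_cartesian_product sum_nbhd_grid)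

lemma weight_ge:
  assumes "roman2_dominating (with_proj (cartesian_product G H)) f"
  shows "min m (2 * n) \<le> weight (with_proj (cartesian_product G H)) f"
proof (cases "\<exists>v \<in> pverts H. (\<Sum>x \<in> pverts G. f (x, v)) = 0")
  case True
  then obtain v where v: "v \<in> pverts H" "(\<Sum>x \<in> pverts G. f (x, v)) = 0" by blast
  then have "f (u, v) = 0" if "u \<in> pverts G" for u using that fin by simp
  then have "2 \<le> (\<Sum>y \<in> pverts H. f (u, y))" if "u \<in> pverts G" for u
    using assms v that unfolding roman2_dominating_grid_iff by fastforce
  then have "(\<Sum>u \<in> pverts G. 2) \<le> weight (with_proj (cartesian_product G H)) f"
    unfolding weight_cartesian_product by (rule sum_mono)
  then show ?thesis using card_verts by simp
next
  case False
  then have "1 \<le> (\<Sum>x \<in> pverts G. f (x, v))" if "v \<in> pverts H" for v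
    using that by (metis One_nat_def Suc_leI neq0_conv)
  then have "(\<Sum>v \<in> pverts H. 1) \<le> (\<Sum>v \<in> pverts H. \<Sum>x \<in> pverts G. f (x, v))"
    by (rule sum_mono)
  then show ?thesis
    using card_verts by (simp add: weight_cartesian_product')
qed

lemma gamma_le_double:
  assumes "m \<ge> 1"
  shows "gamma_R2 (with_proj (cartesian_product G H)) \<le> 2 * n"
proof -
  obtain w where w: "w \<in> pverts H"
    using assms card_verts by fastforce
  define f :: "'a \<times> 'b \<Rightarrow> nat" where "f = (\<lambda>(u, v). if v = w then 2 else 0)"
  have row: "(\<Sum>y \<in> pverts H. f (u, y)) = 2" for u
    using w fin by (simp add: f_def)
  \<comment> \<open>The row sum alone already supplies the required 2.\<close>
  then have "roman2_dominating (with_proj (cartesian_product G H)) f"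
    unfolding roman2_dominating_grid_iff by (simp add: f_def Pi_iff split: prod.split)
  moreover have "weight (with_proj (cartesian_product G H)) f = 2 * n"
    using row card_verts by (simp add: weight_cartesian_product)
  ultimately show ?thesis using gamma_R2_le by metis
qed

lemma gamma_le_columns:
  assumes "n \<ge> 1" "n \<le> m"
  shows "gamma_R2 (with_proj (cartesian_product G H)) \<le> m"
proof -
  \<comment> \<open>Here \<open>n \<le> m\<close> enters: each row \<open>u\<close> is assigned a
    column \<open>g u\<close> of its own.\<close>
  obtain g where g: "inj_on g (pverts G)" "g ` pverts G \<subseteq> pverts H"
    using assms fin card_verts by (metis card_le_inj)
  obtain u0 where u0: "u0 \<in> pverts G" using assms card_verts by fastforce
  \<comment> \<open>\<open>r v\<close> is the row holding the 1 of column \<open>v\<close>: the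
    inverse of \<open>g\<close> on its image, and the default row \<open>u0\<close> elsewhere, so
    that no column stays empty.\<close>
  define r where "r v = (if v \<in> g ` pverts G then inv_into (pverts G) g v else u0)" for v
  have r_in: "r v \<in> pverts G" for v
    using u0 by (auto simp: r_def inv_into_into)
  have r_g: "r (g u) = u" if "u \<in> pverts G" for u
    using that g by (simp add: r_def)
  define f :: "'a \<times> 'b \<Rightarrow> nat" where "f = (\<lambda>(u, v). if u = r v then 1 else 0)"
  have col: "(\<Sum>x \<in> pverts G. f (x, v)) = 1" for v
    using r_in fin by (simp add: f_def)
  have row: "1 \<le> (\<Sum>y \<in> pverts H. f (u, y))" if "u \<in> pverts G" for u
  proof -
    have "g u \<in> pverts H" using g that by blast
    then have "f (u, g u) \<le> (\<Sum>y \<in> pverts H. f (u, y))"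
      using fin by (intro member_le_sum) auto
    then show ?thesis using r_g[OF that] by (simp add: f_def)
  qed
  have "f \<in> pverts G \<times> pverts H \<rightarrow> {0, 1, 2}"
    by (simp add: f_def Pi_iff split: prod.split)
  \<comment> \<open>The 2 required at a zero is split: 1 from its column and at least 1 from its
    row.\<close>
  then have "roman2_dominating (with_proj (cartesian_product G H)) f"
    using row col by (simp add: roman2_dominating_grid_iff)
  moreover have "weight (with_proj (cartesian_product G H)) f = m"
    using col card_verts by (simp add: weight_cartesian_product')
  ultimately show ?thesis using gamma_R2_le by metis
qed

end

theorem theorem3p4:
  fixes G :: "'a pair_pre_digraph" and H :: "'b pair_pre_digraph" and m n :: nat
  assumes "m \<ge> 1" and "n \<ge> 1" and "n \<le> m"
    and "complete_digraph n (with_proj G)" and "complete_digraph m (with_proj H)"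
  shows "gamma_R2 (with_proj (cartesian_product G H)) = min m (2 * n)"
proof -
  interpret complete_grid G H n m using assms by unfold_locales
  have "min m (2 * n) \<le> gamma_R2 (with_proj (cartesian_product G H))"
    using gamma_R2_attained weight_ge by metis
  then show ?thesis
    using gamma_le_double gamma_le_columns assms by (simp add: order_antisym)
qed

end
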